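(* Let $0<q<1$, let $A$ be a random variable with values in $\{0,1,2,\ldots\}$, and for each integer $k\ge 0$ let $$\mathbb{B}(k)=\sum_{i=k}^{\infty}\binom{i}{k}q^k(1-q)^{i-k}\,\mathbb{P}(A=i)$$ (the probability that the new node has in-degree $k$). This series converges to the following expressions. 1. If $A\sim\mathsf{Poisson}(r)$ with $r>0$, then $\mathbb{B}(k)=\frac{(qr)^k}{k!}e^{-qr}$. 2. If $A\sim\mathsf{Binomial}(r,\theta)$ and $0\le\frac{\theta}{1-\theta}(1-q)<1$, then $\mathbb{B}(k)=\binom{r}{k}(q\theta)^k(1-q\theta)^{r-k}$. 3. If $A\sim\mathsf{Geometric}(\theta)$, then $\mathbb{B}(k)=\frac{\theta}{q+\theta(1-q)}\left(\frac{q(1-\theta)}{q+\theta(1-q)}\right)^k$. 4. If $A\sim\mathsf{NegativeBinomial}(r,\theta)$, then $\mathbb{B}(k)=\binom{k+r-1}{r-1}\left(\frac{q(1-\theta)}{q+\theta(1-q)}\right)^k\left(\frac{\theta}{q+\theta(1-q)}\right)^r$. 5. If $A\sim\mathsf{Zeta}(r)$ with $r\ge 1$, then $$\mathbb{B}(k)=\begin{cases}\dfrac{1}{\zeta(r+1)}\mathrm{Li}_{r+1}(1-q), & k=0,\\[2mm] \dfrac{1}{\zeta(r+1)\,k!}\left(\dfrac{q}{1-q}\right)^k\displaystyle\sum_{i=1}^{k}e_{i-1}(1,\ldots,k)\,\mathrm{Li}_{r+i-k}(1-q), & k\ge 1,\end{cases}$$ where $\mathrm{Li}_{r}(x)$ is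 the polylogarithm function and $e_i(1,\ldots,k)$ denotes the elementary symmetric polynomials in $k$ variables (evaluated at $1,\ldots,k$). 6. If $A$ has the log-series distribution with parameter $\theta$, then $$\mathbb{B}(k)=\begin{cases}\dfrac{\ln\left(1+(q-1)\theta\right)}{\ln(1-\theta)}, & k=0,\\[2mm] \dfrac{-1}{k\ln(1-\theta)}\left(\dfrac{q\theta}{1-\theta(1-q)}\right)^k, & k\ge 1.\end{cases}$$
   Context: Interpretation: in a growing directed network, each new node attaches to a random number $A$ of existing nodes, and each of these nodes establishes a reciprocal edge to the new node with probability $q$ (independent Bernoulli trials); $\mathbb{B}(k)$ is the probability that the new node has in-degree $k$. Conventions for the distributions: - $\mathsf{Poisson}(r)$: $\mathbb{P}(A=i)=\frac{r^i}{i!}e^{-r}$, $i\ge 0$. - $\mathsf{Binomial}(r,\theta)$: $\mathbb{P}(A=i)=\binom{r}{i}\theta^i(1-\theta)^{r-i}$, $0\le i\le r$. - $\mathsf{Geometric}(\theta)$: $\mathbb{P}(A=i)=\theta(1-\theta)^i$, $i\ge 0$. - $\mathsf{NegativeBinomial}(r,\theta)$: $\mathbb{P}(A=i)=\binom{r+i-1}{r-1}\theta^r(1-\theta)^i$, $i\ge 0$. - $\mathsf{Zeta}(r)$: $\mathbb{P}(A=i)=\frac{i^{-(r+1)}}{\zeta(r+1)}$, $i\ge 1$, where $\zeta$ is the Riemann zeta function. - Log-series with parameter $\theta$: $\mathbb{P}(A=i)=-\frac{\theta^i}{i\ln(1-\theta)}$, $i\ge 1$. The polylogarithm is $\mathrm{Li}_s(x)=\sum_{i=1}^\infty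 \frac{x^i}{i^s}$ for $|x|<1$. The elementary symmetric polynomial of degree $0$ is $e_0=1$.
   Formalization: In item 5 with k≥1, the elementary symmetric polynomials e_{i-1} are evaluated at 0,-1,…,-(k-1) instead of 1,…,k; the printed formula already fails at k=2, where the sum should be Li_{r-1}(1-q)-Li_r(1-q), not Li_{r-1}(1-q)+3Li_r(1-q). *)

theory Defs
  imports "HOL-Probability.Probability"
begin

text \<open>The \<open>i\<close>-th term of the series for \<open>\<bbbB>(k)\<close>; only the indices \<open>i \<ge> k\<close> occur in that series.\<close>

definition in_degree_term :: "'a measure \<Rightarrow> ('a \<Rightarrow> nat) \<Rightarrow> real \<Rightarrow> nat \<Rightarrow> nat \<Rightarrow> real" where
  "in_degree_term M A q k i =
     real (i choose k) * q ^ k * (1 - q) ^ (i - k) * \<P>(\<omega> in M. A \<omega> = i)"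

text \<open>\<open>in_degree_sums M A q k x\<close> says that the series \<open>\<bbbB>(k) = \<Sum>i=k..\<infinity>. \<dots>\<close> converges to \<open>x\<close>;
  it is reindexed by \<open>i = k + j\<close>.\<close>

definition in_degree_sums :: "'a measure \<Rightarrow> ('a \<Rightarrow> nat) \<Rightarrow> real \<Rightarrow> nat \<Rightarrow> real \<Rightarrow> bool" where
  "in_degree_sums M A q k x \<longleftrightarrow> (\<lambda>j. in_degree_term M A q k (k + j)) sums x"

definition has_mass_function :: "'a measure \<Rightarrow> ('a \<Rightarrow> nat) \<Rightarrow> (nat \<Rightarrow> real) \<Rightarrow> bool" where
  "has_mass_function M A f \<longleftrightarrow> (\<forall>i. \<P>(\<omega> in M. A \<omega> = i) = f i)"

definition poisson_mass :: "real \<Rightarrow> nat \<Rightarrow> real" where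
  "poisson_mass r i = r ^ i / fact i * exp (- r)"

text \<open>For \<open>i > r\<close> the binomial coefficient vanishes, so the truncated exponent is harmless.\<close>

definition binomial_mass :: "nat \<Rightarrow> real \<Rightarrow> nat \<Rightarrow> real" where
  "binomial_mass r \<theta> i = real (r choose i) * \<theta> ^ i * (1 - \<theta>) ^ (r - i)"

definition geometric_mass :: "real \<Rightarrow> nat \<Rightarrow> real" where
  "geometric_mass \<theta> i = \<theta> * (1 - \<theta>) ^ i"

text \<open>Meant for \<open>r \<ge> 1\<close>, where the subtractions do not truncate.\<close>

definition neg_binomial_mass :: "nat \<Rightarrow> real \<Rightarrow> nat \<Rightarrow> real" where
  "neg_binomial_mass r \<theta> i = real ((r + i - 1) choose (r - 1)) * \<theta> ^ r * (1 - \<theta>) ^ i"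

text \<open>The Riemann zeta function through its Dirichlet series; meant for real \<open>s > 1\<close>.\<close>

definition zeta_real :: "real \<Rightarrow> real" where
  "zeta_real s = (\<Sum>n. 1 / real (Suc n) powr s)"

definition zeta_mass :: "real \<Rightarrow> nat \<Rightarrow> real" where
  "zeta_mass r i = (if i = 0 then 0 else real i powr (- (r + 1)) / zeta_real (r + 1))"

definition log_series_mass :: "real \<Rightarrow> nat \<Rightarrow> real" where
  "log_series_mass \<theta> i = (if i = 0 then 0 else - (\<theta> ^ i / (real i * ln (1 - \<theta>))))"

text \<open>The polylogarithm \<open>Li\<^sub>s(x)\<close> of real (possibly negative) order; meant for \<open>\<bar>x\<bar> < 1\<close>.\<close>

definition polylog :: "real \<Rightarrow> real \<Rightarrow> real" where
  "polylog s x = (\<Sum>n. x ^ Suc n / real (Suc n) powr s)"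

text \<open>The elementary symmetric polynomial of degree \<open>j\<close> in the \<open>k\<close> variables \<open>x 1, \<dots>, x k\<close>.\<close>

definition elem_sym :: "nat \<Rightarrow> nat \<Rightarrow> (nat \<Rightarrow> real) \<Rightarrow> real" where
  "elem_sym k j x = (\<Sum>S | S \<subseteq> {1..k} \<and> card S = j. \<Prod>m\<in>S. x m)"

text \<open>The value of \<open>\<bbbB>(k)\<close> for the zeta distribution. It rests on the expansion
  \<open>k! * (n choose k) = n (n - 1) \<dots> (n - k + 1) = (\<Sum>i=1..k. e\<^sub>i\<^sub>-\<^sub>1(0, -1, \<dots>, 1 - k) * n ^ (k + 1 - i))\<close>,
  so the elementary symmetric polynomials in \<open>k\<close> variables are evaluated at the negated roots
  \<open>0, -1, \<dots>, 1 - k\<close>. Evaluating them at \<open>1, \<dots>, k\<close> instead gives the same value for \<open>k = 1\<close> but a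
  wrong one for \<open>k = 2\<close>, namely one too large by a positive multiple of \<open>Li\<^sub>r(1 - q)\<close>.\<close>

definition zeta_in_degree :: "real \<Rightarrow> real \<Rightarrow> nat \<Rightarrow> real" where
  "zeta_in_degree r q k =
     (if k = 0 then 1 / zeta_real (r + 1) * polylog (r + 1) (1 - q)
      else 1 / (zeta_real (r + 1) * fact k) * (q / (1 - q)) ^ k *
        (\<Sum>i=1..k. elem_sym k (i - 1) (\<lambda>m. 1 - real m) * polylog (r + real i - real k) (1 - q)))"

definition log_series_in_degree :: "real \<Rightarrow> real \<Rightarrow> nat \<Rightarrow> real" where
  "log_series_in_degree \<theta> q k =
     (if k = 0 then ln (1 + (q - 1) * \<theta>) / ln (1 - \<theta>)
      else - 1 / (real k * ln (1 - \<theta>)) * (q * \<theta> / (1 - \<theta> * (1 - q))) ^ k)"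

end

theory Submission
  imports Defs "HOL-Real_Asymp.Real_Asymp"
begin

text \<open>In every case the product of \<open>i choose k\<close> with the mass function is rewritten so that a factor
  independent of \<open>i\<close> splits off and a classical series in \<open>i\<close> remains: the exponential, binomial,
  negative binomial or logarithmic series. For the zeta distribution the falling factorial
  \<open>i (i - 1) \<dots> (i - k + 1)\<close> is instead expanded in powers of \<open>i\<close>, each of which contributes a
  polylogarithm.\<close>

section \<open>Reindexing and the negative binomial series\<close>

lemma in_degree_term_mass:
  assumes "has_mass_function M A f"
  shows "in_degree_term M A q k i = real (i choose k) * q ^ k * (1 - q) ^ (i - k) * f i"
  using assms by (simp add: in_degree_term_def has_mass_function_def)

text \<open>The factor \<open>i choose k\<close> vanishes for \<open>i < k\<close>, so prepending
  these terms changes nothing. This form suits series whose natural index is \<open>i\<close> itself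
  rather than \<open>i - k\<close>.\<close>

lemma in_degree_sums_iff: "in_degree_sums M A q k x \<longleftrightarrow> in_degree_term M A q k sums x"
proof -
  have "in_degree_term M A q k i = 0" if "i < k" for i
    using that by (simp add: in_degree_term_def)
  from sums_zero_iff_shift[where n = k and s = x, OF this] show ?thesis
    by (simp add: in_degree_sums_def add.commute)
qed

text \<open>Newton's binomial series at \<open>- x\<close> with exponent \<open>- (m + 1)\<close>.
  Upper negation turns the generalized coefficients into ordinary ones, and its sign cancels against
  that of \<open>(- x) ^ j\<close>.\<close>

lemma negative_binomial_series:
  fixes x :: real
  assumes "\<bar>x\<bar> < 1"
  shows "(\<lambda>j. real ((m + j) choose m) * x ^ j) sums (1 / (1 - x) ^ Suc m)"
proof -
  have coeff: "((- real (Suc m)) gchoose j) * (- x) ^ j = real ((m + j) choose m) * x ^ j" for j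
  proof -
    have "((- real (Suc m)) gchoose j) = (- 1) ^ j * (real (m + j) gchoose j)"
      by (subst gbinomial_minus) simp
    also have "real (m + j) gchoose j = real ((m + j) choose m)"
      using binomial_symmetric[of m "m + j"] by (metis add_diff_cancel_left' binomial_gbinomial le_add1)
    finally show ?thesis
      by (simp add: power_minus[of x])
  qed
  have "(\<lambda>j. ((- real (Suc m)) gchoose j) * (- x) ^ j) sums (1 + - x) powr (- real (Suc m))"
    using assms by (intro gen_binomial_real) simp
  also have "(1 + - x) powr (- real (Suc m)) = 1 / (1 - x) ^ Suc m"
    using assms by (simp add: powr_minus_divide powr_realpow del: of_nat_Suc power_Suc)
  finally show ?thesis
    unfolding coeff .
qed

section \<open>Poisson and binomial distributions\<close>

lemma in_degree_sums_poisson: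
  assumes "has_mass_function M A (poisson_mass r)"
  shows "in_degree_sums M A q k ((q * r) ^ k / fact k * exp (- (q * r)))"
proof -
  have eq: "in_degree_term M A q k (k + j) =
      (q * r) ^ k / fact k * exp (- r) * (((1 - q) * r) ^ j /\<^sub>R fact j)" for j
    by (simp add: in_degree_term_mass[OF assms] poisson_mass_def binomial_fact power_add
        power_mult_distrib divide_simps mult_ac)
  have "(\<lambda>j. (q * r) ^ k / fact k * exp (- r) * (((1 - q) * r) ^ j /\<^sub>R fact j))
      sums ((q * r) ^ k / fact k * exp (- r) * exp ((1 - q) * r))"
    by (intro sums_mult exp_converges)
  moreover have "exp (- r) * exp ((1 - q) * r) = exp (- (q * r))"
    by (simp add: algebra_simps flip: exp_add)
  ultimately show ?thesis
    unfolding in_degree_sums_def eq by (simp add: mult.assoc)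
qed

lemma in_degree_sums_binomial:
  assumes "has_mass_function M A (binomial_mass r \<theta>)"
  shows "in_degree_sums M A q k (real (r choose k) * (q * \<theta>) ^ k * (1 - q * \<theta>) ^ (r - k))"
proof -
  let ?t = "\<lambda>j. in_degree_term M A q k (k + j)"
  have eq: "?t j = real (r choose k) * (q * \<theta>) ^ k *
      (real ((r - k) choose j) * ((1 - q) * \<theta>) ^ j * (1 - \<theta>) ^ (r - k - j))" for j
  proof (cases "k + j \<le> r")
    case True
    \<comment> \<open>Both sides count the ways to choose a \<open>k\<close>-subset inside a
      \<open>(k + j)\<close>-subset of \<open>r\<close> objects.\<close>
    have "((k + j) choose k) * (r choose (k + j)) = (r choose k) * ((r - k) choose j)"
      using choose_mult[of k "k + j" r] True by (simp add: mult.commute)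
    then have "real ((k + j) choose k) * real (r choose (k + j)) =
        real (r choose k) * real ((r - k) choose j)"
      by (metis of_nat_mult)
    then show ?thesis
      by (simp add: in_degree_term_mass[OF assms] binomial_mass_def power_add
          power_mult_distrib mult_ac)
  \<comment> \<open>Both sides vanish here: for \<open>k \<le> r\<close> because \<open>j\<close>
    exceeds \<open>r - k\<close>, for \<open>k > r\<close> because \<open>r choose k\<close> is
    zero. In the latter case \<open>r - k\<close> truncates to 0, so the second coefficient alone
    would not vanish at \<open>j = 0\<close>.\<close>
  next
    case False
    then show ?thesis
      by (cases "k \<le> r")
        (auto simp: in_degree_term_mass[OF assms] binomial_mass_def binomial_eq_0)
  qed
  have "?t sums (\<Sum>j\<le>r - k. ?t j)"
    by (rule sums_finite) (auto simp: eq binomial_eq_0)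
  also have "(\<Sum>j\<le>r - k. ?t j) =
      real (r choose k) * (q * \<theta>) ^ k * ((1 - q) * \<theta> + (1 - \<theta>)) ^ (r - k)"
    by (simp add: eq binomial_ring sum_distrib_left)
  also have "(1 - q) * \<theta> + (1 - \<theta>) = 1 - q * \<theta>"
    by (simp add: algebra_simps)
  finally show ?thesis
    by (simp add: in_degree_sums_def)
qed

section \<open>Negative binomial and geometric distributions\<close>

text \<open>Both sides equal the multinomial coefficient \<open>(k + s + j)! / (k! s! j!)\<close>;
  passing to the reals allows division by factorials.\<close>

lemma choose_mult_neg_binomial:
  "((k + j) choose k) * ((s + (k + j)) choose s) = ((k + s) choose s) * ((k + s + j) choose (k + s))"
proof -
  have "real (((k + j) choose k) * ((s + (k + j)) choose s)) =
      real (((k + s) choose s) * ((k + s + j) choose (k + s)))"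
    by (simp add: binomial_fact add_ac)
  then show ?thesis
    by (metis of_nat_eq_iff)
qed

lemma in_degree_sums_neg_binomial:
  assumes mass: "has_mass_function M A (neg_binomial_mass r \<theta>)"
    and "1 \<le> r" "0 < \<theta>" "\<theta> \<le> 1" "0 < q" "q < 1"
  shows "in_degree_sums M A q k
    (real ((k + r - 1) choose (r - 1)) * (q * (1 - \<theta>) / (q + \<theta> * (1 - q))) ^ k *
      (\<theta> / (q + \<theta> * (1 - q))) ^ r)"
proof -
  from \<open>1 \<le> r\<close> obtain s where r: "r = Suc s"
    by (cases r) auto
  \<comment> \<open>\<open>x\<close> is what each unit of \<open>j\<close> contributes as a power,
    and \<open>c\<close> collects the factors free of \<open>j\<close>.\<close>
  define x where "x = (1 - q) * (1 - \<theta>)"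
  define c where "c = real ((k + s) choose s) * (q * (1 - \<theta>)) ^ k * \<theta> ^ r"
  have x: "1 - x = q + \<theta> * (1 - q)"
    by (simp add: x_def algebra_simps)
  have "0 \<le> x"
    using assms by (simp add: x_def)
  moreover have "0 < 1 - x"
    using assms unfolding x by (intro add_pos_nonneg) auto
  ultimately have "(\<lambda>j. c * (real ((k + s + j) choose (k + s)) * x ^ j)) sums (c * (1 / (1 - x) ^ Suc (k + s)))"
    by (intro sums_mult negative_binomial_series) simp
  \<comment> \<open>The exponent \<open>Suc (k + s)\<close> is \<open>k + r\<close>, so the
    denominator splits between the \<open>k\<close>-th and the \<open>r\<close>-th power.\<close>
  also have "c * (1 / (1 - x) ^ Suc (k + s)) =
      real ((k + r - 1) choose (r - 1)) * (q * (1 - \<theta>) / (q + \<theta> * (1 - q))) ^ k *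
        (\<theta> / (q + \<theta> * (1 - q))) ^ r"
    unfolding x c_def r power_divide by (simp add: power_add)
  also have "(\<lambda>j. c * (real ((k + s + j) choose (k + s)) * x ^ j)) =
      (\<lambda>j. in_degree_term M A q k (k + j))"
  proof
    fix j
    have "real ((k + j) choose k) * real ((s + (k + j)) choose s) =
        real ((k + s) choose s) * real ((k + s + j) choose (k + s))"
      by (metis choose_mult_neg_binomial of_nat_mult)
    moreover have "in_degree_term M A q k (k + j) =
        real ((k + j) choose k) * real ((s + (k + j)) choose s) *
        (q * (1 - \<theta>)) ^ k * \<theta> ^ r * x ^ j"
      by (simp add: in_degree_term_mass[OF mass] neg_binomial_mass_def r x_def power_add
          power_mult_distrib mult_ac)
    ultimately show "c * (real ((k + s + j) choose (k + s)) * x ^ j) = in_degree_term M A q k (k + j)"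
      by (simp add: c_def mult_ac)
  qed
  finally show ?thesis
    by (simp add: in_degree_sums_def)
qed

lemma in_degree_sums_geometric:
  assumes "has_mass_function M A (geometric_mass \<theta>)"
    and "0 < \<theta>" "\<theta> \<le> 1" "0 < q" "q < 1"
  shows "in_degree_sums M A q k
    (\<theta> / (q + \<theta> * (1 - q)) * (q * (1 - \<theta>) / (q + \<theta> * (1 - q))) ^ k)"
proof -
  have "geometric_mass \<theta> = neg_binomial_mass 1 \<theta>"
    by (simp add: fun_eq_iff geometric_mass_def neg_binomial_mass_def)
  then show ?thesis
    using in_degree_sums_neg_binomial[of M A 1 \<theta> q k] assms by (simp add: mult.commute)
qed

section \<open>Polylogarithms, elementary symmetric polynomials and the zeta distribution\<close>

text \<open>The order \<open>s\<close> is arbitrary because the zeta case also needs negative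
  orders, where the terms carry a growing power of \<open>n\<close>. Geometric decay still
  dominates.\<close>

lemma polylog_sums:
  assumes "\<bar>x\<bar> < 1"
  shows "(\<lambda>n. x ^ Suc n / real (Suc n) powr s) sums polylog s x"
proof -
  \<comment> \<open>The midpoint between \<open>\<bar>x\<bar>\<close> and 1 leaves room to absorb
    the power of \<open>n\<close> into \<open>(\<bar>x\<bar> / y) ^ n\<close>.\<close>
  define y where "y = (1 + \<bar>x\<bar>) / 2"
  have y: "0 \<le> \<bar>x\<bar>" "\<bar>x\<bar> < y" "y < 1"
    using assms by (auto simp: y_def)
  have "(\<lambda>n. \<bar>x\<bar> ^ Suc n / real (Suc n) powr s) \<in> O(\<lambda>n. y ^ n)"
  proof (cases "x = 0")
    case False
    then have "0 < \<bar>x\<bar>" by simp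
    then show ?thesis
      using y by real_asymp
  qed simp
  moreover have "summable (\<lambda>n. norm (y ^ n))"
    using y by (simp add: summable_geometric power_abs)
  ultimately have "summable (\<lambda>n. \<bar>x\<bar> ^ Suc n / real (Suc n) powr s)"
    by (rule summable_comparison_test_bigo[rotated])
  also have "(\<lambda>n. \<bar>x\<bar> ^ Suc n / real (Suc n) powr s) = (\<lambda>n. \<bar>x ^ Suc n / real (Suc n) powr s\<bar>)"
    by (simp add: abs_mult power_abs)
  finally show ?thesis
    unfolding polylog_def by (rule summable_sums[OF summable_rabs_cancel])
qed

text \<open>Vieta's formula: multiplying out means choosing the set \<open>S\<close> of factors that
  contribute \<open>x m\<close>, the others contributing \<open>t\<close>; the choices are then
  grouped by \<open>card S\<close>.\<close>

lemma prod_plus_const_elem_sym: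
  "(\<Prod>m=1..k. x m + t) = (\<Sum>j=0..k. elem_sym k j x * t ^ (k - j))"
proof -
  have "(\<Prod>m=1..k. x m + t) = (\<Sum>S\<in>Pow {1..k}. (\<Prod>m\<in>S. x m) * t ^ (k - card S))"
    by (subst prod_add) (auto intro!: sum.cong simp: card_Diff_subset finite_subset)
  also have "\<dots> = (\<Sum>j=0..k. \<Sum>S | S \<in> Pow {1..k} \<and> card S = j.
      (\<Prod>m\<in>S. x m) * t ^ (k - card S))"
    by (rule sum.group[symmetric]) (auto simp: card_mono[of "{1..k}", simplified])
  also have "\<dots> = (\<Sum>j=0..k. elem_sym k j x * t ^ (k - j))"
    by (auto simp: elem_sym_def sum_distrib_right intro!: sum.cong)
  finally show ?thesis .
qed

lemma fact_mult_choose_elem_sym: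
  assumes "1 \<le> k"
  shows "fact k * real (n choose k) =
    (\<Sum>i=1..k. elem_sym k (i - 1) (\<lambda>m. 1 - real m) * real n ^ (k + 1 - i))"
proof -
  let ?x = "\<lambda>m. 1 - real m"
  have "fact k * real (n choose k) = (\<Prod>i=0..<k. real n - real i)"
    by (simp add: binomial_gbinomial gbinomial_prod_rev)
  also have "\<dots> = (\<Prod>m=1..k. ?x m + real n)"
    by (rule prod.reindex_bij_witness[of _ "\<lambda>m. m - 1" Suc]) auto
  also have "\<dots> = (\<Sum>j=0..k. elem_sym k j ?x * real n ^ (k - j))"
    by (rule prod_plus_const_elem_sym)
  \<comment> \<open>The only \<open>k\<close>-subset is \<open>{1..k}\<close>, whose product
    contains the zero factor at \<open>m = 1\<close>. Hence the constant term in \<open>n\<close>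
    drops out and the sum ends at \<open>i = k\<close>.\<close>
  also have "elem_sym k k ?x = 0"
  proof -
    have "{S. S \<subseteq> {1..k} \<and> card S = k} = {{1..k}}"
      using card_subset_eq[of "{1..k}"] by auto
    then show ?thesis
      using assms by (auto simp: elem_sym_def)
  qed
  then have "(\<Sum>j=0..k. elem_sym k j ?x * real n ^ (k - j)) =
      (\<Sum>j=0..<k. elem_sym k j ?x * real n ^ (k - j))"
    by (simp add: sum.last_plus)
  also have "\<dots> = (\<Sum>i=1..k. elem_sym k (i - 1) ?x * real n ^ (k + 1 - i))"
    by (rule sum.reindex_bij_witness[of _ "\<lambda>i. i - 1" Suc]) auto
  finally show ?thesis .
qed

lemma in_degree_sums_zeta:
  assumes mass: "has_mass_function M A (zeta_mass r)" and q: "0 < q" "q < 1"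
  shows "in_degree_sums M A q k (zeta_in_degree r q k)"
proof -
  let ?z = "zeta_real (r + 1)"
  let ?e = "\<lambda>i. elem_sym k (i - 1) (\<lambda>m. 1 - real m)"
  let ?li = "\<lambda>s n. (1 - q) ^ Suc n / real (Suc n) powr s"
  have li: "?li s sums polylog s (1 - q)" for s
    using q by (intro polylog_sums) simp
  \<comment> \<open>The mass at 0 is zero, so summation can start at 1, which matches the indexing
    of \<open>polylog\<close>.\<close>
  have "(\<lambda>n. in_degree_term M A q k (Suc n)) sums zeta_in_degree r q k"
  proof (cases "k = 0")
    case True
    have "(\<lambda>n. 1 / ?z * ?li (r + 1) n) sums (1 / ?z * polylog (r + 1) (1 - q))"
      by (intro sums_mult li)
    moreover have "in_degree_term M A q k (Suc n) = 1 / ?z * ?li (r + 1) n" for n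
      unfolding in_degree_term_mass[OF mass] zeta_mass_def True powr_minus_divide by simp
    ultimately show ?thesis
      using True by (simp add: zeta_in_degree_def)
  next
    case False
    let ?c = "1 / (?z * fact k) * (q / (1 - q)) ^ k"
    have "(\<lambda>n. ?c * (\<Sum>i=1..k. ?e i * ?li (r + real i - real k) n)) sums
        (?c * (\<Sum>i=1..k. ?e i * polylog (r + real i - real k) (1 - q)))"
      by (intro sums_mult sums_sum li)
    moreover have "in_degree_term M A q k (Suc n) =
        ?c * (\<Sum>i=1..k. ?e i * ?li (r + real i - real k) n)" for n
    proof -
      let ?N = "real (Suc n)"
      \<comment> \<open>Each power in the falling factorial lowers the order \<open>r + 1\<close> of
        the polylogarithm by its exponent; \<open>i \<le> k\<close> keeps the natural subtraction
        exact.\<close>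
      have pow: "?N ^ (k + 1 - i) * ?N powr (- (r + 1)) = 1 / ?N powr (r + real i - real k)"
        if "i \<in> {1..k}" for i
      proof -
        have "?N ^ (k + 1 - i) = ?N powr (real k + 1 - real i)"
          using that by (subst powr_realpow[symmetric]) (auto simp: of_nat_diff add_ac)
        then show ?thesis
          by (simp add: powr_minus_divide[symmetric] powr_add[symmetric] algebra_simps del: of_nat_Suc)
      qed
      have "fact k * real (Suc n choose k) * ?N powr (- (r + 1)) =
          (\<Sum>i=1..k. ?e i * (?N ^ (k + 1 - i) * ?N powr (- (r + 1))))"
        using False by (subst fact_mult_choose_elem_sym) (auto simp: sum_distrib_right mult.assoc)
      also have "\<dots> = (\<Sum>i=1..k. ?e i * (1 / ?N powr (r + real i - real k)))"
        using pow by (intro sum.cong) auto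
      finally have *: "real (Suc n choose k) * ?N powr (- (r + 1)) =
          (\<Sum>i=1..k. ?e i * (1 / ?N powr (r + real i - real k))) / fact k"
        by (simp add: field_simps del: of_nat_Suc)
      have "in_degree_term M A q k (Suc n) =
          q ^ k * (1 - q) ^ (Suc n - k) / ?z * (real (Suc n choose k) * ?N powr (- (r + 1)))"
        unfolding in_degree_term_mass[OF mass] zeta_mass_def by simp
      also have "\<dots> = (q / (1 - q)) ^ k * (1 - q) ^ Suc n / ?z *
          (real (Suc n choose k) * ?N powr (- (r + 1)))"
      \<comment> \<open>For \<open>k > Suc n\<close> the exponent \<open>Suc n - k\<close>
        truncates, but then the binomial coefficient is zero on both sides.\<close>
      proof (cases "k \<le> Suc n")
        case True
        then have "(1 - q) ^ (Suc n - k) = (1 - q) ^ Suc n / (1 - q) ^ k"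
          using q by (intro power_diff) auto
        then show ?thesis
          by (simp add: power_divide del: power_Suc)
      qed (simp add: binomial_eq_0)
      also have "\<dots> = ?c * ((1 - q) ^ Suc n * (\<Sum>i=1..k. ?e i * (1 / ?N powr (r + real i - real k))))"
        unfolding * by simp
      finally show ?thesis
        by (simp add: sum_distrib_left mult_ac del: of_nat_Suc power_Suc)
    qed
    ultimately show ?thesis
      using False by (simp add: zeta_in_degree_def)
  qed
  moreover have "in_degree_term M A q k 0 = 0"
    by (simp add: in_degree_term_mass[OF mass] zeta_mass_def)
  ultimately show ?thesis
    by (simp add: in_degree_sums_iff sums_Suc_iff)
qed

section \<open>Log-series distribution\<close>

lemma in_degree_sums_log_series:
  assumes mass: "has_mass_function M A (log_series_mass \<theta>)"
    and "0 < \<theta>" "\<theta> < 1" "0 < q" "q < 1"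
  shows "in_degree_sums M A q k (log_series_in_degree \<theta> q k)"
proof -
  define x where "x = (1 - q) * \<theta>"
  have "0 < x" "x < 1 * 1"
    using assms unfolding x_def by (simp, intro mult_strict_mono) auto
  then have x: "\<bar>x\<bar> < 1" by simp
  show ?thesis
  proof (cases k)
    case 0
    \<comment> \<open>This is the series of \<open>ln (1 + y)\<close> at \<open>y = - x\<close>. Its
      term at \<open>n = 0\<close> is a division by zero, hence 0, in agreement with the mass at
      0.\<close>
    have "(\<lambda>n. - ((- (- x)) ^ n) / real n / ln (1 - \<theta>)) sums (ln (1 + (- x)) / ln (1 - \<theta>))"
      using x by (intro sums_divide ln_series') simp
    moreover have "in_degree_term M A q k = (\<lambda>n. - ((- (- x)) ^ n) / real n / ln (1 - \<theta>))"
      by (simp add: fun_eq_iff in_degree_term_mass[OF mass] log_series_mass_def 0 x_def power_mult_distrib)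
    moreover have "1 + (- x) = 1 + (q - 1) * \<theta>"
      by (simp add: x_def algebra_simps)
    ultimately show ?thesis
      unfolding in_degree_sums_iff log_series_in_degree_def 0 by (simp only: if_True simp_thms)
  next
    case (Suc m)
    let ?c = "- 1 / (real k * ln (1 - \<theta>)) * (q * \<theta>) ^ k"
    have "(\<lambda>j. ?c * (real ((m + j) choose m) * x ^ j)) sums (?c * (1 / (1 - x) ^ Suc m))"
      using x by (intro sums_mult negative_binomial_series)
    moreover have "in_degree_term M A q k (k + j) = ?c * (real ((m + j) choose m) * x ^ j)" for j
    proof -
      \<comment> \<open>The absorption identity removes the factor \<open>1 / (k + j)\<close> of the
        mass function at the cost of \<open>1 / k\<close>, leaving a negative binomial
        series.\<close>
      have "k * ((k + j) choose k) = (k + j) * ((m + j) choose m)"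
        using Suc_times_binomial[of m "m + j"] Suc by simp
      then have "real k * real ((k + j) choose k) = real (k + j) * real ((m + j) choose m)"
        by (metis of_nat_mult)
      then have "real ((k + j) choose k) / real (k + j) = real ((m + j) choose m) / real k"
        using Suc by (simp add: field_simps)
      moreover have "in_degree_term M A q k (k + j) =
          - (real ((k + j) choose k) / real (k + j)) * (q * \<theta>) ^ k * x ^ j / ln (1 - \<theta>)"
        using Suc unfolding in_degree_term_mass[OF mass] log_series_mass_def
        by (simp add: x_def power_mult_distrib power_add)
      ultimately show ?thesis
        by (simp only:) simp
    qed
    moreover have "?c * (1 / (1 - x) ^ Suc m) = log_series_in_degree \<theta> q k"
      unfolding log_series_in_degree_def power_divide x_def Suc by (simp add: mult.commute)
    ultimately show ?thesis
      by (simp add: in_degree_sums_def)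
  qed
qed

theorem theorem3p1:
  fixes M :: "'a measure" and A :: "'a \<Rightarrow> nat" and q :: real
  assumes "prob_space M"
    and "A \<in> measurable M (count_space UNIV)"
    and "0 < q" and "q < 1"
  shows
    "(\<forall>r > 0. has_mass_function M A (poisson_mass r) \<longrightarrow>
        (\<forall>k. in_degree_sums M A q k ((q * r) ^ k / fact k * exp (- (q * r)))))
   \<and> (\<forall>r \<theta>. 0 \<le> \<theta> \<and> \<theta> < 1 \<and> 0 \<le> \<theta> / (1 - \<theta>) * (1 - q) \<and> \<theta> / (1 - \<theta>) * (1 - q) < 1 \<and>
        has_mass_function M A (binomial_mass r \<theta>) \<longrightarrow>
        (\<forall>k. in_degree_sums M A q k (real (r choose k) * (q * \<theta>) ^ k * (1 - q * \<theta>) ^ (r - k))))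
   \<and> (\<forall>\<theta>. 0 < \<theta> \<and> \<theta> \<le> 1 \<and> has_mass_function M A (geometric_mass \<theta>) \<longrightarrow>
        (\<forall>k. in_degree_sums M A q k
          (\<theta> / (q + \<theta> * (1 - q)) * (q * (1 - \<theta>) / (q + \<theta> * (1 - q))) ^ k)))
   \<and> (\<forall>r \<theta>. 1 \<le> r \<and> 0 < \<theta> \<and> \<theta> \<le> 1 \<and> has_mass_function M A (neg_binomial_mass r \<theta>) \<longrightarrow>
        (\<forall>k. in_degree_sums M A q k
          (real ((k + r - 1) choose (r - 1)) * (q * (1 - \<theta>) / (q + \<theta> * (1 - q))) ^ k *
            (\<theta> / (q + \<theta> * (1 - q))) ^ r)))
   \<and> (\<forall>r \<ge> 1. has_mass_function M A (zeta_mass r) \<longrightarrow>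
        (\<forall>k. in_degree_sums M A q k (zeta_in_degree r q k)))
   \<and> (\<forall>\<theta>. 0 < \<theta> \<and> \<theta> < 1 \<and> has_mass_function M A (log_series_mass \<theta>) \<longrightarrow>
        (\<forall>k. in_degree_sums M A q k (log_series_in_degree \<theta> q k)))"
  by (intro conjI allI impI in_degree_sums_poisson in_degree_sums_binomial
      in_degree_sums_geometric in_degree_sums_neg_binomial in_degree_sums_zeta
      in_degree_sums_log_series; (elim conjE)?; use assms(3,4) in simp)

end
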